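(* An SCF $f:\Theta\to Z$ satisfying $|f(\Theta)|\ge 2$ is mixed-Nash-implementable if and only if $\widehat{\mathcal L}^Y$-monotonicity holds.
   Context: Standing setup: $\mathcal I=\{1,\dots,I\}$ is a finite set of agents with $I\ge 3$; $\Theta$ is a finite or countably infinite set of states; $Z$ is a finite set of pure outcomes; $Y=\Delta(Z)$, each $z\in Z$ identified with the degenerate lottery at $z$. For each $(i,\theta)$, $u_i^\theta:Z\to\mathbb R$ and $U_i^\theta(y)=\sum_{z}y_zu_i^\theta(z)$. For $\alpha\in Y$: $\mathcal L_i^Y(\alpha,\theta)=\{y\in Y:U_i^\theta(\alpha)\ge U_i^\theta(y)\}$, $\mathcal L_i^Z(\alpha,\theta)=\{z\in Z:U_i^\theta(\alpha)\ge u_i^\theta(z)\}$. A mechanism is $\mathcal M=\langle M=\times_iM_i,g:M\to Y\rangle$ with each $M_i$ countable; $g(\lambda)$ is the lottery induced by a (mixed) profile $\lambda$; $MNE^{(\mathcal M,\theta)}$ is the set of mixed-strategy Nash equilibria at $\theta$. $f$ is mixed-Nash-implementable if some mechanism satisfies $\bigcup_{\lambda\in MNE^{(\mathcal M,\theta)}}\mathrm{SUPP}(g[\lambda])=\{f(\theta)\}$ for all $\theta$. A nonempty $E\subseteq Z$ is an $i$-$\theta$-max set if $E\subseteq\arg\max_{z\in E}u_i^\theta(z)$ and $E\subseteq\arg\max_{z\in Z}u_j^\theta(z)$ for all $j\neq i$; an $i$-max set if it is an $i$-$\theta$-max set for some $\theta$. For $(i,\theta)$ and $a\in Z$, define $\widehat{\mathcal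 L}_i^Y(a,\theta)=\{a\}$ if $a=f(\theta)\in\arg\min_{z\in Z}u_i^\theta(z)$ and $\mathcal L_i^Z(f(\theta),\theta)$ is an $i$-max set, and $\widehat{\mathcal L}_i^Y(a,\theta)=\mathcal L_i^Y(a,\theta)$ otherwise. $\widehat{\mathcal L}^Y$-monotonicity holds if for all $\theta,\theta'\in\Theta$: $\widehat{\mathcal L}_i^Y(f(\theta),\theta)\subseteq\mathcal L_i^Y(f(\theta),\theta')$ for all $i$ implies $f(\theta)=f(\theta')$. *)

theory Defs
  imports "HOL-Probability.Product_PMF"
begin

text \<open>Agents: a finite type 'i; states: a countable type 'th (Theta = UNIV);
  pure outcomes: a finite type 'z (Z = UNIV); lotteries Y = Delta(Z) are 'z pmf;
  a pure outcome z is identified with return_pmf z.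
  Utilities are given by u :: 'i => 'th => 'z => real.\<close>

definition EU :: "('i \<Rightarrow> 'th \<Rightarrow> 'z::finite \<Rightarrow> real) \<Rightarrow> 'i \<Rightarrow> 'th \<Rightarrow> 'z pmf \<Rightarrow> real" where
  "EU u i \<theta> y = (\<Sum>z\<in>UNIV. pmf y z * u i \<theta> z)"

definition LY :: "('i \<Rightarrow> 'th \<Rightarrow> 'z::finite \<Rightarrow> real) \<Rightarrow> 'i \<Rightarrow> 'z pmf \<Rightarrow> 'th \<Rightarrow> 'z pmf set" where
  "LY u i \<alpha> \<theta> = {y. EU u i \<theta> \<alpha> \<ge> EU u i \<theta> y}"

definition LZ :: "('i \<Rightarrow> 'th \<Rightarrow> 'z::finite \<Rightarrow> real) \<Rightarrow> 'i \<Rightarrow> 'z pmf \<Rightarrow> 'th \<Rightarrow> 'z set" where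
  "LZ u i \<alpha> \<theta> = {z. EU u i \<theta> \<alpha> \<ge> u i \<theta> z}"

definition is_max_set_at :: "('i \<Rightarrow> 'th \<Rightarrow> 'z::finite \<Rightarrow> real) \<Rightarrow> 'i \<Rightarrow> 'th \<Rightarrow> 'z set \<Rightarrow> bool" where
  "is_max_set_at u i \<theta> E \<longleftrightarrow> E \<noteq> {}
     \<and> (\<forall>z\<in>E. \<forall>z'\<in>E. u i \<theta> z \<ge> u i \<theta> z')
     \<and> (\<forall>j. j \<noteq> i \<longrightarrow> (\<forall>z\<in>E. \<forall>z'. u j \<theta> z \<ge> u j \<theta> z'))"

definition is_max_set :: "('i \<Rightarrow> 'th \<Rightarrow> 'z::finite \<Rightarrow> real) \<Rightarrow> 'i \<Rightarrow> 'z set \<Rightarrow> bool" where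
  "is_max_set u i E \<longleftrightarrow> (\<exists>\<theta>. is_max_set_at u i \<theta> E)"

definition LYhat :: "('i \<Rightarrow> 'th \<Rightarrow> 'z::finite \<Rightarrow> real) \<Rightarrow> ('th \<Rightarrow> 'z) \<Rightarrow> 'i \<Rightarrow> 'z \<Rightarrow> 'th \<Rightarrow> 'z pmf set" where
  "LYhat u f i a \<theta> =
     (if a = f \<theta> \<and> (\<forall>z. u i \<theta> a \<le> u i \<theta> z) \<and> is_max_set u i (LZ u i (return_pmf (f \<theta>)) \<theta>)
      then {return_pmf a} else LY u i (return_pmf a) \<theta>)"

definition LYhat_monotone :: "('i \<Rightarrow> 'th \<Rightarrow> 'z::finite \<Rightarrow> real) \<Rightarrow> ('th \<Rightarrow> 'z) \<Rightarrow> bool" where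
  "LYhat_monotone u f \<longleftrightarrow> (\<forall>\<theta> \<theta>'.
     (\<forall>i. LYhat u f i (f \<theta>) \<theta> \<subseteq> LY u i (return_pmf (f \<theta>)) \<theta>') \<longrightarrow> f \<theta> = f \<theta>')"

text \<open>Mechanisms: message spaces M i are countable; w.l.o.g. (up to relabelling)
  subsets of nat. g maps pure message profiles to lotteries. A mixed profile
  assigns to every agent a pmf supported on M i; the induced lottery is the
  product distribution pushed through g.\<close>

definition outcome :: "(('i::finite \<Rightarrow> nat) \<Rightarrow> 'z pmf) \<Rightarrow> ('i \<Rightarrow> nat pmf) \<Rightarrow> 'z pmf" where
  "outcome g p = bind_pmf (Pi_pmf UNIV 0 p) g"

definition is_profile :: "('i \<Rightarrow> nat set) \<Rightarrow> ('i \<Rightarrow> nat pmf) \<Rightarrow> bool" where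
  "is_profile M p \<longleftrightarrow> (\<forall>i. set_pmf (p i) \<subseteq> M i)"

definition MNE :: "('i \<Rightarrow> 'th \<Rightarrow> 'z::finite \<Rightarrow> real) \<Rightarrow> ('i::finite \<Rightarrow> nat set) \<Rightarrow>
    (('i \<Rightarrow> nat) \<Rightarrow> 'z pmf) \<Rightarrow> 'th \<Rightarrow> ('i \<Rightarrow> nat pmf) set" where
  "MNE u M g \<theta> = {p. is_profile M p \<and>
     (\<forall>i \<mu>. set_pmf \<mu> \<subseteq> M i \<longrightarrow> EU u i \<theta> (outcome g (p(i := \<mu>))) \<le> EU u i \<theta> (outcome g p))}"

definition mixed_Nash_implementable :: "('i::finite \<Rightarrow> 'th \<Rightarrow> 'z::finite \<Rightarrow> real) \<Rightarrow> ('th \<Rightarrow> 'z) \<Rightarrow> bool" where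
  "mixed_Nash_implementable u f \<longleftrightarrow> (\<exists>(M :: 'i \<Rightarrow> nat set) (g :: ('i \<Rightarrow> nat) \<Rightarrow> 'z pmf).
     \<forall>\<theta>. (\<Union>p\<in>MNE u M g \<theta>. set_pmf (outcome g p)) = {f \<theta>})"

end

theory Submission
  imports Defs
begin

text \<open>
  Necessity: an equilibrium at \<open>\<theta>\<close> confines the deviations of \<open>i\<close> to the lower contour set of
  \<open>f \<theta>\<close>. If \<open>f \<theta>\<close> is worst for \<open>i\<close> and this contour set is an \<open>i\<close>-max set at \<open>\<theta>2\<close>, then
  every deviation of \<open>i\<close> produces a new equilibrium at \<open>\<theta>2\<close>, so all of them lead to
  \<open>f \<theta>2 = f \<theta>\<close>. Hence the equilibrium survives at every \<open>\<theta>'\<close> with nested contour sets.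

  Sufficiency: in the canonical mechanism below, an equilibrium at \<open>s\<close> gives each agent, at
  every profile played, the best lottery attainable against the messages of the others. If all
  agree on \<open>\<theta>\<close>, monotonicity yields \<open>f \<theta> = f s\<close>. Otherwise the outcome includes every outcome
  in reach of a single agent \<open>w\<close>, all others are free to pick anything, and so these outcomes
  form a \<open>w\<close>-max set. As \<open>f\<close> is not constant this cannot be all of \<open>Z\<close>, and the only other
  possibility is the singleton case of the truncated contour set, where monotonicity applies again.
\<close>

section \<open>Expected utility\<close>

lemma EU_eq_expectation: "EU u i \<theta> y = measure_pmf.expectation y (u i \<theta>)"
  unfolding EU_def by (subst integral_measure_pmf[where A = UNIV]) auto

lemma EU_return [simp]: "EU u i \<theta> (return_pmf z) = u i \<theta> z"
  by (simp add: EU_eq_expectation)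

lemma expectation_le:
  fixes v :: "'z::finite \<Rightarrow> real"
  assumes "\<And>z. z \<in> set_pmf y \<Longrightarrow> v z \<le> c"
  shows "measure_pmf.expectation y v \<le> c"
proof -
  have "measure_pmf.expectation y v \<le> measure_pmf.expectation y (\<lambda>_. c)"
    by (intro integral_mono_AE integrable_measure_pmf_finite)
       (auto simp: AE_measure_pmf_iff assms)
  then show ?thesis by simp
qed

lemma expectation_nonpos_imp_zero:
  fixes h :: "'a \<Rightarrow> real"
  assumes "integrable (measure_pmf y) h" "\<And>z. z \<in> set_pmf y \<Longrightarrow> 0 \<le> h z"
    and "measure_pmf.expectation y h \<le> 0" "z \<in> set_pmf y"
  shows "h z = 0"
proof -
  have ae: "AE z in measure_pmf y. 0 \<le> h z"
    by (auto simp: AE_measure_pmf_iff assms)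
  have "measure_pmf.expectation y h = 0"
    using integral_nonneg_AE[OF ae] assms(3) by simp
  then have "AE z in measure_pmf y. h z = 0"
    using integral_nonneg_eq_0_iff_AE[OF assms(1) ae] by simp
  then show ?thesis using assms(4) by (auto simp: AE_measure_pmf_iff)
qed

lemma expectation_attained:
  fixes v :: "'z::finite \<Rightarrow> real"
  assumes le: "\<And>z. z \<in> set_pmf y \<Longrightarrow> v z \<le> measure_pmf.expectation y v"
    and z: "z \<in> set_pmf y"
  shows "v z = measure_pmf.expectation y v"
proof -
  have int: "integrable (measure_pmf y) v"
    by (intro integrable_measure_pmf_finite) auto
  have "measure_pmf.expectation y v - v z = 0"
    by (rule expectation_nonpos_imp_zero[where y = y]) (use int le z in auto)
  then show ?thesis by simp
qed

lemma EU_le: "(\<And>z. z \<in> set_pmf y \<Longrightarrow> u i \<theta> z \<le> c) \<Longrightarrow> EU u i \<theta> y \<le> c"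
  unfolding EU_eq_expectation by (rule expectation_le)

lemma EU_ge: "(\<And>z. z \<in> set_pmf y \<Longrightarrow> c \<le> u i \<theta> z) \<Longrightarrow> c \<le> EU u i \<theta> y"
  using EU_le[of y "\<lambda>i \<theta> z. - u i \<theta> z" i \<theta> "- c"] by (simp add: EU_eq_expectation)

lemma EU_max_imp_support:
  assumes "\<And>z. u i \<theta> z \<le> EU u i \<theta> y" "z \<in> set_pmf y"
  shows "u i \<theta> z = EU u i \<theta> y"
  using assms expectation_attained[of y "u i \<theta>" z] by (simp add: EU_eq_expectation)

lemma EU_min_imp_support:
  assumes "\<And>z. EU u i \<theta> y \<le> u i \<theta> z" "z \<in> set_pmf y"
  shows "u i \<theta> z = EU u i \<theta> y"
  using EU_max_imp_support[of "\<lambda>i \<theta> z. - u i \<theta> z" i \<theta> y z] assms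
  by (simp add: EU_eq_expectation)

lemma EU_bounded:
  fixes u :: "'i \<Rightarrow> 'th \<Rightarrow> 'z::finite \<Rightarrow> real"
  obtains B where "\<And>y. \<bar>EU u i \<theta> y\<bar> \<le> B"
proof -
  have "\<bar>EU u i \<theta> y\<bar> \<le> (\<Sum>z\<in>UNIV. \<bar>u i \<theta> z\<bar>)" for y
    unfolding EU_def
    by (rule order_trans[OF sum_abs]) (auto intro!: sum_mono mult_left_le_one_le simp: abs_mult pmf_le_1)
  then show thesis by (rule that)
qed

text \<open>Mixed strategies may have infinite support, so integrability comes from boundedness,
  outcomes being finite in number.\<close>

lemma integrable_EU:
  fixes u :: "'i \<Rightarrow> 'th \<Rightarrow> 'z::finite \<Rightarrow> real"
  shows "integrable (measure_pmf P) (\<lambda>m. EU u i \<theta> (g m))"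
proof -
  obtain B where "\<And>y. \<bar>EU u i \<theta> y\<bar> \<le> B" by (rule EU_bounded[of u i \<theta>]) blast
  then show ?thesis by (intro measure_pmf.integrable_const_bound[where B = B]) auto
qed

lemma EU_bind: "EU u i \<theta> (bind_pmf P g) = measure_pmf.expectation P (\<lambda>m. EU u i \<theta> (g m))"
proof -
  have "integrable (measure_pmf P) (\<lambda>m. pmf (g m) z)" for z
    by (intro measure_pmf.integrable_const_bound[where B = 1]) (auto simp: pmf_le_1)
  then show ?thesis unfolding EU_def pmf_bind by simp
qed

section \<open>Mixtures of two lotteries\<close>

definition mix :: "real \<Rightarrow> 'a pmf \<Rightarrow> 'a pmf \<Rightarrow> 'a pmf" where
  "mix t x y = bind_pmf (bernoulli_pmf t) (\<lambda>b. if b then x else y)"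

lemma EU_mix:
  assumes "0 \<le> t" "t \<le> 1"
  shows "EU u i \<theta> (mix t x y) = t * EU u i \<theta> x + (1 - t) * EU u i \<theta> y"
  unfolding mix_def EU_bind using assms by simp

lemma expectation_mix:
  fixes v :: "'z::finite \<Rightarrow> real"
  assumes "0 \<le> t" "t \<le> 1"
  shows "measure_pmf.expectation (mix t x y) v =
    t * measure_pmf.expectation x v + (1 - t) * measure_pmf.expectation y v"
  \<comment> \<open>Any real function \<open>v\<close> serves as the utility of a dummy agent in a
    dummy state.\<close>
  using EU_mix[OF assms, of "\<lambda>(_::unit) (_::unit). v" "()" "()"] by (simp add: EU_eq_expectation)

lemma set_pmf_mix:
  assumes "0 < t" "t \<le> 1"
  shows "set_pmf x \<subseteq> set_pmf (mix t x y)"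
proof
  fix z assume "z \<in> set_pmf x"
  moreover have "True \<in> set_pmf (bernoulli_pmf t)"
    using assms by (simp add: set_pmf_iff)
  ultimately show "z \<in> set_pmf (mix t x y)"
    by (force simp: mix_def)
qed

section \<open>Necessity\<close>

lemma outcome_implemented:
  assumes "(\<Union>p\<in>MNE u M g \<theta>. set_pmf (outcome g p)) = {f \<theta>}" "p \<in> MNE u M g \<theta>"
  shows "outcome g p = return_pmf (f \<theta>)"
  using assms by (subst set_pmf_subset_singleton[symmetric]) auto

lemma is_profile_update:
  "is_profile M p \<Longrightarrow> set_pmf \<mu> \<subseteq> M i \<Longrightarrow> is_profile M (p(i := \<mu>))"
  by (auto simp: is_profile_def)

lemma deviation_in_LYhat:
  fixes u :: "'i::finite \<Rightarrow> 'th \<Rightarrow> 'z::finite \<Rightarrow> real"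
  assumes impl: "\<And>\<theta>. (\<Union>p\<in>MNE u M g \<theta>. set_pmf (outcome g p)) = {f \<theta>}"
    and p: "p \<in> MNE u M g \<theta>" and \<mu>: "set_pmf \<mu> \<subseteq> M i"
  shows "outcome g (p(i := \<mu>)) \<in> LYhat u f i (f \<theta>) \<theta>"
proof -
  have prof: "is_profile M p" using p by (simp add: MNE_def)
  have out: "outcome g p = return_pmf (f \<theta>)"
    using impl p by (rule outcome_implemented)
  have dev: "EU u i \<theta> (outcome g (p(i := \<nu>))) \<le> u i \<theta> (f \<theta>)" if "set_pmf \<nu> \<subseteq> M i" for \<nu>
    using p that out unfolding MNE_def by fastforce
  let ?E = "LZ u i (return_pmf (f \<theta>)) \<theta>"
  show ?thesis
  proof (cases "(\<forall>z. u i \<theta> (f \<theta>) \<le> u i \<theta> z) \<and> is_max_set u i ?E")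
    case False
    then show ?thesis using dev[OF \<mu>] unfolding LYhat_def LY_def by auto
  next
    case True
    then obtain \<theta>2 where max: "is_max_set_at u i \<theta>2 ?E" by (auto simp: is_max_set_def)
    \<comment> \<open>As \<open>f \<theta>\<close> is worst for \<open>i\<close>, a lottery no
      better than it can only put weight on outcomes that tie with it.\<close>
    have supp: "set_pmf (outcome g (p(i := \<nu>))) \<subseteq> ?E" if "set_pmf \<nu> \<subseteq> M i" for \<nu>
    proof
      fix z assume z: "z \<in> set_pmf (outcome g (p(i := \<nu>)))"
      have "u i \<theta> z = EU u i \<theta> (outcome g (p(i := \<nu>)))"
        using z True dev[OF that] by (intro EU_min_imp_support) (auto intro: order_trans)
      then show "z \<in> ?E" using dev[OF that] by (simp add: LZ_def)
    qed
    have fE: "f \<theta> \<in> ?E" by (simp add: LZ_def)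
    have indiff: "EU u i \<theta>2 (outcome g (p(i := \<nu>))) = u i \<theta>2 (f \<theta>)"
      if "set_pmf \<nu> \<subseteq> M i" for \<nu>
    proof (intro antisym EU_le EU_ge)
      fix z assume "z \<in> set_pmf (outcome g (p(i := \<nu>)))"
      then have "z \<in> ?E" using supp[OF that] by blast
      then show "u i \<theta>2 z \<le> u i \<theta>2 (f \<theta>)" "u i \<theta>2 (f \<theta>) \<le> u i \<theta>2 z"
        using max fE unfolding is_max_set_at_def by blast+
    qed
    \<comment> \<open>At \<open>\<theta>2\<close> all lotteries within reach of \<open>i\<close> are
      worth the same to \<open>i\<close>, while everyone else already receives a global
      maximum.\<close>
    have nash: "p(i := \<nu>) \<in> MNE u M g \<theta>2" if \<nu>: "set_pmf \<nu> \<subseteq> M i" for \<nu>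
      unfolding MNE_def
    proof (intro CollectI conjI allI impI)
      show "is_profile M (p(i := \<nu>))" using prof \<nu> by (rule is_profile_update)
      fix j \<rho> assume \<rho>: "set_pmf \<rho> \<subseteq> M j"
      show "EU u j \<theta>2 (outcome g (p(i := \<nu>, j := \<rho>))) \<le> EU u j \<theta>2 (outcome g (p(i := \<nu>)))"
      proof (cases "j = i")
        case True
        then show ?thesis using \<rho> \<nu> indiff by simp
      next
        case False
        have "u j \<theta>2 z' \<le> u j \<theta>2 z" if "z \<in> set_pmf (outcome g (p(i := \<nu>)))" for z z'
          using that supp[OF \<nu>] max False unfolding is_max_set_at_def by blast
        then show ?thesis by (intro EU_le EU_ge)
      qed
    qed
    have eq: "outcome g (p(i := \<nu>)) = return_pmf (f \<theta>2)" if "set_pmf \<nu> \<subseteq> M i" for \<nu>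
      using impl nash[OF that] by (rule outcome_implemented)
    \<comment> \<open>The trivial deviation gives back \<open>p\<close>, which ties
      \<open>f \<theta>2\<close> to \<open>f \<theta>\<close>.\<close>
    have "outcome g (p(i := p i)) = return_pmf (f \<theta>2)"
      using prof by (intro eq) (simp add: is_profile_def)
    then have "f \<theta>2 = f \<theta>" using out by simp
    then show ?thesis using True eq[OF \<mu>] by (simp add: LYhat_def)
  qed
qed

lemma implementable_imp_monotone:
  fixes u :: "'i::finite \<Rightarrow> 'th \<Rightarrow> 'z::finite \<Rightarrow> real"
  assumes "mixed_Nash_implementable u f"
  shows "LYhat_monotone u f"
  unfolding LYhat_monotone_def
proof (intro allI impI)
  fix \<theta> \<theta>' assume sub: "\<forall>i. LYhat u f i (f \<theta>) \<theta> \<subseteq> LY u i (return_pmf (f \<theta>)) \<theta>'"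
  obtain M :: "'i \<Rightarrow> nat set" and g where
    impl: "\<And>\<theta>. (\<Union>p\<in>MNE u M g \<theta>. set_pmf (outcome g p)) = {f \<theta>}"
    using assms unfolding mixed_Nash_implementable_def by blast
  obtain p where p: "p \<in> MNE u M g \<theta>" using impl[of \<theta>] by blast
  have out: "outcome g p = return_pmf (f \<theta>)" using impl p by (rule outcome_implemented)
  have "p \<in> MNE u M g \<theta>'"
    unfolding MNE_def
  proof (intro CollectI conjI allI impI)
    show "is_profile M p" using p by (simp add: MNE_def)
    fix i \<mu> assume "set_pmf \<mu> \<subseteq> M i"
    then have "outcome g (p(i := \<mu>)) \<in> LYhat u f i (f \<theta>) \<theta>"
      using impl p by (intro deviation_in_LYhat)
    then show "EU u i \<theta>' (outcome g (p(i := \<mu>))) \<le> EU u i \<theta>' (outcome g p)"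
      using sub out by (auto simp: LY_def)
  qed
  with impl have "outcome g p = return_pmf (f \<theta>')" by (rule outcome_implemented)
  with out show "f \<theta> = f \<theta>'" by simp
qed

section \<open>Central lotteries\<close>

text \<open>A stand-in for a relative interior point: a utility that is maximised over \<open>S\<close>
  at \<open>y\<close> has to be flat on every outcome that \<open>S\<close> can reach.\<close>

definition central :: "'z pmf set \<Rightarrow> 'z pmf \<Rightarrow> bool" where
  "central S y \<longleftrightarrow> y \<in> S \<and> (\<forall>x\<in>S. set_pmf x \<subseteq> set_pmf y) \<and>
     (\<forall>v :: 'z \<Rightarrow> real. (\<forall>x\<in>S. measure_pmf.expectation x v \<le> measure_pmf.expectation y v) \<longrightarrow>
        (\<forall>z\<in>set_pmf y. v z = measure_pmf.expectation y v))"

text \<open>Each point of \<open>E\<close> competes with the average over \<open>E\<close>; if the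
  average is maximal, no point exceeds it, hence all equal it.\<close>

lemma central_pmf_of_set:
  fixes E :: "'z::finite set"
  assumes "E \<noteq> {}" "\<And>z. z \<in> E \<Longrightarrow> return_pmf z \<in> S" "pmf_of_set E \<in> S"
    "\<And>x. x \<in> S \<Longrightarrow> set_pmf x \<subseteq> E"
  shows "central S (pmf_of_set E)"
  unfolding central_def
proof (intro conjI ballI allI impI)
  fix v :: "'z \<Rightarrow> real" and z
  assume max: "\<forall>x\<in>S. measure_pmf.expectation x v \<le> measure_pmf.expectation (pmf_of_set E) v"
    and z: "z \<in> set_pmf (pmf_of_set E)"
  show "v z = measure_pmf.expectation (pmf_of_set E) v"
    using z assms(1) assms(2)[THEN max[rule_format]] by (intro expectation_attained) auto
qed (use assms in auto)

lemma central_UNIV: "central (UNIV :: 'z::finite pmf set) (pmf_of_set UNIV)"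
  by (rule central_pmf_of_set) auto

lemma LZ_worst:
  fixes u :: "'i \<Rightarrow> 'th \<Rightarrow> 'z::finite \<Rightarrow> real"
  assumes "\<And>z. u i \<theta> a \<le> u i \<theta> z"
  shows "y \<in> LY u i (return_pmf a) \<theta> \<longleftrightarrow> set_pmf y \<subseteq> LZ u i (return_pmf a) \<theta>"
proof
  assume y: "y \<in> LY u i (return_pmf a) \<theta>"
  show "set_pmf y \<subseteq> LZ u i (return_pmf a) \<theta>"
  proof
    fix z assume "z \<in> set_pmf y"
    then have "u i \<theta> z = EU u i \<theta> y"
      using y assms by (intro EU_min_imp_support) (auto simp: LY_def intro: order_trans)
    then show "z \<in> LZ u i (return_pmf a) \<theta>" using y by (simp add: LZ_def LY_def)
  qed
next
  assume "set_pmf y \<subseteq> LZ u i (return_pmf a) \<theta>"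
  then show "y \<in> LY u i (return_pmf a) \<theta>" by (auto simp: LY_def LZ_def intro!: EU_le)
qed

text \<open>An outcome \<open>w\<close> strictly worse than \<open>a\<close> leaves slack: any
  lottery, diluted enough with \<open>w\<close>, falls below \<open>a\<close>, and one degree of
  dilution suits all lotteries.\<close>

lemma LY_contains_mixtures:
  fixes u :: "'i \<Rightarrow> 'th \<Rightarrow> 'z::finite \<Rightarrow> real"
  assumes "u i \<theta> w < u i \<theta> a"
  obtains \<delta> where "0 < \<delta>" "\<delta> \<le> 1"
    "\<And>y. mix \<delta> y (return_pmf w) \<in> LY u i (return_pmf a) \<theta>"
proof -
  define B where "B = Max (range (u i \<theta>))"
  have B: "u i \<theta> z \<le> B" for z by (simp add: B_def)
  \<comment> \<open>The weight at which mixing a best outcome with \<open>w\<close> is exactly as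
    good as \<open>a\<close>.\<close>
  define \<delta> where "\<delta> = (u i \<theta> a - u i \<theta> w) / (B - u i \<theta> w)"
  have pos: "0 < B - u i \<theta> w" using assms B[of a] by linarith
  have \<delta>: "0 < \<delta>" "\<delta> \<le> 1"
    using assms B[of a] pos by (auto simp: \<delta>_def)
  have "EU u i \<theta> (mix \<delta> y (return_pmf w)) \<le> u i \<theta> a" for y
  proof -
    have "\<delta> * EU u i \<theta> y \<le> \<delta> * B"
      using \<delta> B by (intro mult_left_mono EU_le) auto
    moreover have "\<delta> * (B - u i \<theta> w) = u i \<theta> a - u i \<theta> w"
      using pos by (simp add: \<delta>_def)
    ultimately have "\<delta> * EU u i \<theta> y + (1 - \<delta>) * u i \<theta> w \<le> u i \<theta> a"
      by (simp only: algebra_simps)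
    then show ?thesis using \<delta> by (simp add: EU_mix)
  qed
  then show thesis using \<delta> by (intro that[of \<delta>]) (auto simp: LY_def)
qed

lemma ex_central_LY:
  fixes u :: "'i \<Rightarrow> 'th \<Rightarrow> 'z::finite \<Rightarrow> real"
  shows "\<exists>y. central (LY u i (return_pmf a) \<theta>) y"
proof (cases "\<forall>z. u i \<theta> a \<le> u i \<theta> z")
  case True
  have "a \<in> LZ u i (return_pmf a) \<theta>" by (simp add: LZ_def)
  then have "central (LY u i (return_pmf a) \<theta>) (pmf_of_set (LZ u i (return_pmf a) \<theta>))"
    using True set_pmf_of_set[of "LZ u i (return_pmf a) \<theta>"]
    by (intro central_pmf_of_set) (fastforce simp: LZ_worst)+
  then show ?thesis by blast
next
  case False
  then obtain w where "u i \<theta> w < u i \<theta> a" by (auto simp: not_le)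
  then obtain \<delta> where \<delta>: "0 < \<delta>" "\<delta> \<le> 1"
    and in_LY: "\<And>y. mix \<delta> y (return_pmf w) \<in> LY u i (return_pmf a) \<theta>"
    by (rule LY_contains_mixtures) blast
  \<comment> \<open>The uniform lottery, diluted into the contour set.\<close>
  let ?y = "mix \<delta> (pmf_of_set UNIV) (return_pmf w)"
  have full: "set_pmf ?y = UNIV" using set_pmf_mix[OF \<delta>, of "pmf_of_set (UNIV :: 'z set)"]
    by auto
  have "central (LY u i (return_pmf a) \<theta>) ?y"
    unfolding central_def
  proof (intro conjI ballI allI impI)
    fix v :: "'z \<Rightarrow> real" and z
    assume max: "\<forall>x\<in>LY u i (return_pmf a) \<theta>.
      measure_pmf.expectation x v \<le> measure_pmf.expectation ?y v"
    \<comment> \<open>The competitors are point masses with the same dilution, so the common part at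
      \<open>w\<close> cancels.\<close>
    have le: "v z \<le> measure_pmf.expectation (pmf_of_set UNIV) v" for z
      using max[rule_format, OF in_LY[of "return_pmf z"]] \<delta> by (simp add: expectation_mix)
    then have "v z = measure_pmf.expectation (pmf_of_set UNIV) v" for z
      by (intro expectation_attained) auto
    then have "v = (\<lambda>_. measure_pmf.expectation (pmf_of_set UNIV) v)" by blast
    then obtain c where "v = (\<lambda>_. c)" by blast
    then show "v z = measure_pmf.expectation ?y v" by simp
  qed (use in_LY full in auto)
  then show ?thesis by blast
qed

lemma ex_central_LYhat:
  fixes u :: "'i \<Rightarrow> 'th \<Rightarrow> 'z::finite \<Rightarrow> real"
  shows "\<exists>y. central (LYhat u f i a \<theta>) y"
proof -
  have "central {return_pmf a} (return_pmf a)" by (simp add: central_def)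
  then show ?thesis using ex_central_LY by (auto simp: LYhat_def)
qed

text \<open>Without truncation the support of \<open>y\<close> is everything the lower contour set
  reaches. If \<open>f \<theta>\<close> is worst, this is the contour set of pure outcomes, whose
  being a max set would have triggered truncation; otherwise dilution reaches every outcome.\<close>

lemma central_max_set_imp_singleton:
  fixes u :: "'i \<Rightarrow> 'th \<Rightarrow> 'z::finite \<Rightarrow> real"
  assumes central: "central (LYhat u f i (f \<theta>) \<theta>) y"
    and max: "is_max_set u i (set_pmf y)" and not_max: "\<not> is_max_set u i UNIV"
  shows "LYhat u f i (f \<theta>) \<theta> = {return_pmf (f \<theta>)}"
proof (rule ccontr)
  assume "\<not> ?thesis"
  then have LY: "LYhat u f i (f \<theta>) \<theta> = LY u i (return_pmf (f \<theta>)) \<theta>"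
    and cond: "\<not> ((\<forall>z. u i \<theta> (f \<theta>) \<le> u i \<theta> z) \<and> is_max_set u i (LZ u i (return_pmf (f \<theta>)) \<theta>))"
    by (auto simp: LYhat_def split: if_splits)
  have y: "y \<in> LY u i (return_pmf (f \<theta>)) \<theta>"
    and supp: "\<And>x. x \<in> LY u i (return_pmf (f \<theta>)) \<theta> \<Longrightarrow> set_pmf x \<subseteq> set_pmf y"
    using central by (auto simp: central_def LY)
  show False
  proof (cases "\<forall>z. u i \<theta> (f \<theta>) \<le> u i \<theta> z")
    case True
    have "set_pmf y = LZ u i (return_pmf (f \<theta>)) \<theta>"
    proof
      show "set_pmf y \<subseteq> LZ u i (return_pmf (f \<theta>)) \<theta>" using y True by (simp add: LZ_worst)
      show "LZ u i (return_pmf (f \<theta>)) \<theta> \<subseteq> set_pmf y"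
      proof
        fix z assume "z \<in> LZ u i (return_pmf (f \<theta>)) \<theta>"
        then have "return_pmf z \<in> LY u i (return_pmf (f \<theta>)) \<theta>" by (simp add: LZ_def LY_def)
        then show "z \<in> set_pmf y" using supp by fastforce
      qed
    qed
    then show False using max cond True by simp
  next
    case False
    then obtain w where "u i \<theta> w < u i \<theta> (f \<theta>)" by (auto simp: not_le)
    then obtain \<delta> where \<delta>: "0 < \<delta>" "\<delta> \<le> 1"
      and in_LY: "\<And>x. mix \<delta> x (return_pmf w) \<in> LY u i (return_pmf (f \<theta>)) \<theta>"
      by (rule LY_contains_mixtures) blast
    have "z \<in> set_pmf y" for z
      using set_pmf_mix[OF \<delta>, of "return_pmf z" "return_pmf w"] supp[OF in_LY[of "return_pmf z"]]
      by auto
    then have "set_pmf y = UNIV" by blast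
    then show False using max not_max by simp
  qed
qed

lemma mix_in_LYhat:
  assumes "0 \<le> t" "t \<le> 1" "x \<in> LYhat u f i a \<theta>" "y \<in> LYhat u f i a \<theta>"
  shows "mix t x y \<in> LYhat u f i a \<theta>"
proof (cases "LYhat u f i a \<theta> = {return_pmf a}")
  case True
  then have "mix t x y = return_pmf a" using assms by (simp add: mix_def bind_pmf_const)
  then show ?thesis using True by simp
next
  case False
  then have LY: "LYhat u f i a \<theta> = LY u i (return_pmf a) \<theta>"
    by (auto simp: LYhat_def split: if_splits)
  have "t * EU u i \<theta> x + (1 - t) * EU u i \<theta> y \<le> u i \<theta> a"
    using assms unfolding LY by (intro convex_bound_le) (auto simp: LY_def)
  then show ?thesis using assms unfolding LY by (simp add: LY_def EU_mix)
qed

lemma return_in_LYhat: "return_pmf a \<in> LYhat u f i a \<theta>"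
  by (simp add: LYhat_def LY_def)

lemma LYhat_subset_LY: "LYhat u f i a \<theta> \<subseteq> LY u i (return_pmf a) \<theta>"
  by (auto simp: LYhat_def LY_def)

text \<open>A slack of \<epsilon> below the supremum avoids any compactness argument about
  \<open>S\<close>.\<close>

lemma ex_near_optimal:
  fixes u :: "'i \<Rightarrow> 'th \<Rightarrow> 'z::finite \<Rightarrow> real"
  assumes "S \<noteq> {}" "0 < \<epsilon>"
  shows "\<exists>y\<in>S. \<forall>x\<in>S. EU u i \<theta> x \<le> EU u i \<theta> y + \<epsilon>"
proof -
  obtain B where B: "\<And>y. \<bar>EU u i \<theta> y\<bar> \<le> B" by (rule EU_bounded[of u i \<theta>]) blast
  then have "EU u i \<theta> y \<le> B" for y using abs_le_D1 by blast
  then have bdd: "bdd_above (EU u i \<theta> ` S)" by (intro bdd_aboveI2)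
  have "Sup (EU u i \<theta> ` S) - \<epsilon> < Sup (EU u i \<theta> ` S)" using assms by simp
  then obtain y where y: "y \<in> S" "Sup (EU u i \<theta> ` S) - \<epsilon> < EU u i \<theta> y"
    using less_cSup_iff[OF _ bdd] assms by blast
  show ?thesis
  proof (intro bexI[OF _ y(1)] ballI)
    fix x assume "x \<in> S"
    then have "EU u i \<theta> x \<le> Sup (EU u i \<theta> ` S)" using bdd by (intro cSup_upper) auto
    then show "EU u i \<theta> x \<le> EU u i \<theta> y + \<epsilon>" using y(2) by simp
  qed
qed

section \<open>The mechanism\<close>

text \<open>A message encodes a state together with a number. Number \<open>0\<close> consents to the state;
  a positive number claims that it is the true state. The outcome depends on at most one
  agent, the lone dissenter or the agent with the highest number, who is awarded a lottery
  that is nearly optimal at the claimed state. The admixture of a central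
  lottery, which fades as the number grows, is what makes bad equilibria unravel.\<close>

definition unanimous_except :: "('i \<Rightarrow> nat) \<Rightarrow> 'i \<Rightarrow> 'th::countable \<Rightarrow> bool" where
  "unanimous_except m i \<theta> \<longleftrightarrow> (\<forall>j. j \<noteq> i \<longrightarrow> from_nat (m j) = (\<theta>, 0::nat))"

text \<open>If the others agree on no state, the condition is vacuous and every lottery is
  attainable.\<close>

definition attainable ::
  "('i \<Rightarrow> 'th::countable \<Rightarrow> 'z::finite \<Rightarrow> real) \<Rightarrow> ('th \<Rightarrow> 'z) \<Rightarrow> 'i \<Rightarrow> ('i \<Rightarrow> nat) \<Rightarrow> 'z pmf set" where
  "attainable u f i m = {y. \<forall>\<theta>. unanimous_except m i \<theta> \<longrightarrow> y \<in> LYhat u f i (f \<theta>) \<theta>}"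

definition center :: "'z pmf set \<Rightarrow> 'z pmf" where
  "center S = (SOME y. central S y)"

definition near_optimal ::
  "('i \<Rightarrow> 'th \<Rightarrow> 'z::finite \<Rightarrow> real) \<Rightarrow> 'i \<Rightarrow> 'z pmf set \<Rightarrow> 'th \<Rightarrow> nat \<Rightarrow> 'z pmf" where
  "near_optimal u i S \<theta> k = (SOME y. y \<in> S \<and> (\<forall>x\<in>S. EU u i \<theta> x \<le> EU u i \<theta> y + 1 / real (Suc k)))"

text \<open>\<open>Suc\<close> keeps the weight of the center positive and at most 1, also for
  number 0.\<close>

definition award ::
  "('i \<Rightarrow> 'th \<Rightarrow> 'z::finite \<Rightarrow> real) \<Rightarrow> 'i \<Rightarrow> 'z pmf set \<Rightarrow> 'th \<times> nat \<Rightarrow> 'z pmf" where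
  "award u i S c = mix (1 / real (Suc (snd c))) (center S) (near_optimal u i S (fst c) (snd c))"

text \<open>Messages are bare numbers, so the state type is passed along to fix how they are
  decoded.\<close>

definition leads :: "'th::countable itself \<Rightarrow> ('i \<Rightarrow> nat) \<Rightarrow> 'i \<Rightarrow> bool" where
  "leads _ m i \<longleftrightarrow> (if \<exists>j. \<exists>\<theta>::'th. unanimous_except m j \<theta> then \<exists>\<theta>::'th. unanimous_except m i \<theta>
     else \<forall>j. snd (from_nat (m j) :: 'th \<times> nat) \<le> snd (from_nat (m i) :: 'th \<times> nat))"

text \<open>With three agents or more, \<open>SOME\<close> only breaks ties for the highest number,
  since a lone dissenter is unique.\<close>

definition mechanism ::
  "('i \<Rightarrow> 'th::countable \<Rightarrow> 'z::finite \<Rightarrow> real) \<Rightarrow> ('th \<Rightarrow> 'z) \<Rightarrow> ('i \<Rightarrow> nat) \<Rightarrow> 'z pmf" where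
  "mechanism u f m =
     (if \<exists>\<theta>::'th. \<forall>i. from_nat (m i) = (\<theta>, 0::nat)
      then return_pmf (f (THE \<theta>. \<forall>i. from_nat (m i) = (\<theta>, 0::nat)))
      else let i = (SOME i. leads TYPE('th) m i) in award u i (attainable u f i m) (from_nat (m i)))"

lemma unanimous_except_update [simp]:
  "unanimous_except (m(i := x)) i \<theta> \<longleftrightarrow> unanimous_except m i \<theta>"
  by (auto simp: unanimous_except_def)

text \<open>The reach of an agent is fixed by the others; the own message only selects within
  it.\<close>

lemma attainable_update [simp]: "attainable u f i (m(i := x)) = attainable u f i m"
  by (simp add: attainable_def)

lemma leads_unanimous:
  fixes \<theta> :: "'th::countable"
  assumes "leads TYPE('th) m i" "unanimous_except m j \<theta>"
  shows "\<exists>\<theta>'::'th. unanimous_except m i \<theta>'"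
proof -
  have "\<exists>j. \<exists>\<theta>::'th. unanimous_except m j \<theta>" using assms(2) by blast
  then show ?thesis using assms(1) by (simp only: leads_def if_True)
qed

lemma leads_highest:
  assumes "leads TYPE('th::countable) m i" "\<And>\<theta>::'th. \<not> unanimous_except m i \<theta>"
  shows "snd (from_nat (m j) :: 'th \<times> nat) \<le> snd (from_nat (m i) :: 'th \<times> nat)"
proof -
  have "\<not> (\<exists>j. \<exists>\<theta>::'th. unanimous_except m j \<theta>)" using leads_unanimous assms by metis
  then show ?thesis using assms(1) by (simp only: leads_def if_False)
qed

lemma ex_leads: "\<exists>i::'i::finite. leads TYPE('th::countable) m i"
proof (cases "\<exists>j. \<exists>\<theta>::'th. unanimous_except m j \<theta>")
  case True
  then show ?thesis by (auto simp: leads_def)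
next
  case False
  let ?k = "\<lambda>i. snd (from_nat (m i) :: 'th \<times> nat)"
  have "Max (range ?k) \<in> range ?k" by (rule Max_in) auto
  then obtain i where "?k i = Max (range ?k)" by force
  then have "\<forall>j. ?k j \<le> ?k i" by simp
  then show ?thesis using False by (auto simp: leads_def)
qed

locale Nash_setting =
  fixes u :: "'i::finite \<Rightarrow> 'th::countable \<Rightarrow> 'z::finite \<Rightarrow> real" and f :: "'th \<Rightarrow> 'z"
  assumes agents: "CARD('i) \<ge> 3"
    and nonconstant: "card (range f) \<ge> 2"
    and monotone: "LYhat_monotone u f"
begin

abbreviation "g \<equiv> mechanism u f"

section \<open>Consequences of monotonicity and of a third agent\<close>

lemma monotoneD:
  "(\<And>i. LYhat u f i (f \<theta>) \<theta> \<subseteq> LY u i (return_pmf (f \<theta>)) \<theta>') \<Longrightarrow> f \<theta> = f \<theta>'"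
  using monotone unfolding LYhat_monotone_def by blast

text \<open>If all agents were indifferent among all outcomes at \<open>s\<close>, every lower
  contour set at \<open>s\<close> would be everything, and monotonicity would make \<open>f\<close>
  constant.\<close>

lemma not_max_set_UNIV: "\<not> is_max_set u i UNIV"
proof
  assume "is_max_set u i UNIV"
  then obtain s where s: "is_max_set_at u i s UNIV" by (auto simp: is_max_set_def)
  have flat: "u j s z \<le> u j s z'" for j z z'
    using s by (cases "j = i") (auto simp: is_max_set_at_def)
  then have "LY u j (return_pmf a) s = UNIV" for j a
    by (auto simp: LY_def intro!: EU_le)
  then have "f \<theta> = f s" for \<theta> by (intro monotoneD) auto
  then have "range f = {f s}" by auto
  then have "card (range f) = 1" by simp
  then show False using nonconstant by simp
qed

text \<open>The assumption of three agents enters through this lemma.\<close>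

lemma other_agent:
  obtains l :: 'i where "l \<noteq> i" "l \<noteq> j"
proof -
  have "card {i, j} \<le> 2" by (simp add: card_insert_if)
  then have "{i, j} \<noteq> UNIV" using agents by force
  then show thesis using that by blast
qed

lemma unanimous_except_unique:
  assumes "unanimous_except m (i::'i) (\<theta>::'th)" "unanimous_except m i \<theta>'"
  shows "\<theta> = \<theta>'"
  using assms other_agent[of i i] unfolding unanimous_except_def by (metis prod.inject)

text \<open>A third agent belongs to both agreements and so identifies the two states;
  \<open>i\<close> and \<open>j\<close> are each covered by the agreement around the other.\<close>

lemma unanimous_except_two:
  assumes i: "unanimous_except m (i::'i) (\<theta>::'th)" and j: "unanimous_except m j (\<theta>' :: 'th)" and "i \<noteq> j"
  shows "from_nat (m l) = (\<theta>, 0::nat)"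
proof -
  obtain k where "k \<noteq> i" "k \<noteq> j" by (rule other_agent)
  then have "\<theta> = \<theta>'" using i j unfolding unanimous_except_def by (metis prod.inject)
  then show ?thesis using i j \<open>i \<noteq> j\<close> unfolding unanimous_except_def by (cases "l = i") auto
qed

section \<open>Attainable lotteries and outcomes of the mechanism\<close>

lemma attainable_unanimous:
  "unanimous_except m i (\<theta> :: 'th) \<Longrightarrow> attainable u f i m = LYhat u f i (f \<theta>) \<theta>"
  using unanimous_except_unique by (fastforce simp: attainable_def)

lemma attainable_cases:
  obtains (free) "attainable u f i m = UNIV"
  | (lone) \<theta> :: 'th where "unanimous_except m i \<theta>" "attainable u f i m = LYhat u f i (f \<theta>) \<theta>"
proof (cases "\<exists>\<theta>::'th. unanimous_except m i \<theta>")
  case True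
  then show thesis using attainable_unanimous lone by blast
next
  case False
  then show thesis using free by (auto simp: attainable_def)
qed

lemma central_center: "central (attainable u f i m) (center (attainable u f i m))"
proof -
  have "\<exists>y. central (attainable u f i m) y"
    by (rule attainable_cases[of i m]) (use central_UNIV ex_central_LYhat in metis)+
  then show ?thesis unfolding center_def by (rule someI_ex)
qed

lemma near_optimal:
  assumes "S \<noteq> {}"
  shows "near_optimal u i S \<theta> k \<in> S"
    "x \<in> S \<Longrightarrow> EU u i \<theta> x \<le> EU u i \<theta> (near_optimal u i S \<theta> k) + 1 / real (Suc k)"
proof -
  have "\<exists>y. y \<in> S \<and> (\<forall>x\<in>S. EU u i \<theta> x \<le> EU u i \<theta> y + 1 / real (Suc k))"
    using ex_near_optimal[OF assms, of "1 / real (Suc k)" u i \<theta>] by auto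
  from someI_ex[OF this] show "near_optimal u i S \<theta> k \<in> S"
    "x \<in> S \<Longrightarrow> EU u i \<theta> x \<le> EU u i \<theta> (near_optimal u i S \<theta> k) + 1 / real (Suc k)"
    unfolding near_optimal_def by blast+
qed

lemma attainable_nonempty: "attainable u f i m \<noteq> {}"
  using central_center[of i m] by (auto simp: central_def)

lemma award_attainable: "award u i (attainable u f i m) c \<in> attainable u f i m"
proof -
  have c: "center (attainable u f i m) \<in> attainable u f i m"
    using central_center by (simp add: central_def)
  have n: "near_optimal u i (attainable u f i m) (fst c) (snd c) \<in> attainable u f i m"
    using attainable_nonempty by (rule near_optimal)
  show ?thesis
  proof (cases rule: attainable_cases[of i m])
    case free
    then show ?thesis by simp
  next
    case (lone \<theta>)
    show ?thesis
      using c n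
      unfolding award_def lone(2) by (intro mix_in_LYhat) auto
  qed
qed

lemma mechanism_agree:
  assumes "\<And>i. from_nat (m i) = (\<theta>, 0::nat)"
  shows "g m = return_pmf (f \<theta>)"
  using assms by (simp add: mechanism_def)

lemma mechanism_leader:
  assumes "\<nexists>\<theta>::'th. \<forall>i. from_nat (m i) = (\<theta>, 0::nat)"
  shows "\<exists>i. leads TYPE('th) m i \<and> g m = award u i (attainable u f i m) (from_nat (m i))"
  using someI_ex[OF ex_leads[where 'th = 'th and m = m]] assms
  by (intro exI[of _ "SOME i. leads TYPE('th) m i"]) (auto simp: mechanism_def Let_def)

text \<open>If the others agree on \<theta> but not everyone does, a leader other than
  \<open>i\<close> would be a second dissenter, which forces full agreement. So \<open>i\<close>
  leads, and the award lies in its own set.\<close>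

lemma mechanism_attainable: "g m \<in> attainable u f i m"
  unfolding attainable_def
proof (intro CollectI allI impI)
  fix \<theta> :: 'th assume una: "unanimous_except m i \<theta>"
  show "g m \<in> LYhat u f i (f \<theta>) \<theta>"
  proof (cases "\<exists>\<theta>::'th. \<forall>i. from_nat (m i) = (\<theta>, 0::nat)")
    case True
    then obtain \<theta>' where eq: "\<And>i. from_nat (m i) = (\<theta>' :: 'th, 0::nat)" by blast
    then have "unanimous_except m i \<theta>'" by (simp add: unanimous_except_def)
    then have "\<theta> = \<theta>'" using una unanimous_except_unique by blast
    then show ?thesis using mechanism_agree[of m] eq by (simp add: return_in_LYhat)
  next
    case False
    obtain w where w: "leads TYPE('th) m w" "g m = award u w (attainable u f w m) (from_nat (m w))"
      using mechanism_leader[OF False] by blast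
    obtain \<theta>' :: 'th where "unanimous_except m w \<theta>'" using leads_unanimous[OF w(1) una] by blast
    then have "w = i" using unanimous_except_two[OF una] False by metis
    then show ?thesis
      using w(2) award_attainable[of i m] attainable_unanimous[OF una] by simp
  qed
qed

text \<open>A positive number is no consent, so no other agent can be a lone dissenter; a rival
  leader would need a number of at least \<open>k\<close>.\<close>

lemma mechanism_outbid:
  assumes "\<And>j. j \<noteq> i \<Longrightarrow> snd (from_nat (m j) :: 'th \<times> nat) < k"
  shows "g (m(i := to_nat (s::'th, k))) = award u i (attainable u f i m) (s, k)"
proof -
  let ?m = "m(i := to_nat (s, k))"
  obtain j where "j \<noteq> i" using other_agent by blast
  then have k: "k > 0" using assms by fastforce
  then have disagree: "\<nexists>\<theta>::'th. \<forall>j. from_nat (?m j) = (\<theta>, 0::nat)" by (auto dest!: spec[of _ i])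
  obtain w where w: "leads TYPE('th) ?m w"
    "g ?m = award u w (attainable u f w ?m) (from_nat (?m w))"
    using mechanism_leader[OF disagree] by blast
  have "w = i"
  proof (rule ccontr)
    assume "w \<noteq> i"
    then have "\<not> unanimous_except ?m w (\<theta>::'th)" for \<theta>
      using k by (auto simp: unanimous_except_def)
    then have "snd (from_nat (?m i) :: 'th \<times> nat) \<le> snd (from_nat (?m w) :: 'th \<times> nat)"
      by (rule leads_highest[OF w(1)])
    then show False using assms[OF \<open>w \<noteq> i\<close>] \<open>w \<noteq> i\<close> by simp
  qed
  then show ?thesis using w(2) by simp
qed

text \<open>Near-optimality costs at most \<open>1 / Suc k\<close>, and the admixed center, of
  weight \<open>1 / Suc k\<close>, at most \<open>2 * B\<close> times its weight.\<close>

lemma award_near_optimal: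
  assumes B: "\<And>y. \<bar>EU u i s y\<bar> \<le> B" and x: "x \<in> attainable u f i m"
  shows "EU u i s x - (1 + 2 * B) / real (Suc k) \<le> EU u i s (award u i (attainable u f i m) (s, k))"
proof -
  define t where "t = 1 / real (Suc k)"
  have t: "0 \<le> t" "t \<le> 1" by (auto simp: t_def)
  let ?c = "center (attainable u f i m)" and ?n = "near_optimal u i (attainable u f i m) s k"
  have "EU u i s x \<le> EU u i s ?n + t"
    using near_optimal(2)[OF attainable_nonempty x] by (simp add: t_def)
  moreover have "t * (EU u i s ?n - EU u i s ?c) \<le> t * (2 * B)"
    using B[of ?n] B[of ?c] t by (intro mult_left_mono) auto
  moreover have "(1 + 2 * B) / real (Suc k) = t + t * (2 * B)" by (simp add: t_def field_simps)
  moreover have "EU u i s (award u i (attainable u f i m) (s, k)) =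
      t * EU u i s ?c + (1 - t) * EU u i s ?n"
    using EU_mix[OF t] by (simp add: award_def t_def)
  ultimately show ?thesis by (simp add: algebra_simps)
qed

section \<open>Equilibria of the mechanism\<close>

lemma outcome_pure_deviation:
  "outcome h (p(i := return_pmf x)) = bind_pmf (Pi_pmf UNIV 0 p) (\<lambda>m :: 'i \<Rightarrow> nat. h (m(i := x)))"
proof -
  have eq: "insert i (UNIV - {i}) = UNIV" by blast
  \<comment> \<open>Coordinate \<open>i\<close> splits off as an independent draw, which overwriting
    by \<open>x\<close> discards.\<close>
  have *: "Pi_pmf UNIV 0 q = map_pmf (\<lambda>(y, h). h(i := y)) (pair_pmf (q i) (Pi_pmf (UNIV - {i}) 0 q))"
    for q :: "'i \<Rightarrow> nat pmf"
    using Pi_pmf_insert[of "UNIV - {i}" i 0 q] by (simp add: eq)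
  have "Pi_pmf (UNIV - {i}) 0 (p(i := return_pmf x)) = Pi_pmf (UNIV - {i}) 0 p"
    by (rule Pi_pmf_cong) auto
  then show ?thesis
    unfolding outcome_def *[of p] *[of "p(i := return_pmf x)"]
    by (simp add: map_pmf_def pair_pmf_def bind_assoc_pmf bind_return_pmf bind_pmf_const)
qed

text \<open>Claiming the true state with ever higher numbers secures, in the limit, the best attainable
  lottery against every message profile simultaneously; in equilibrium nothing better than
  the actual outcome can be attainable at any profile that is played.\<close>

lemma equilibrium_optimal:
  assumes p: "p \<in> MNE u (\<lambda>_. UNIV) g s"
    and m0: "m0 \<in> set_pmf (Pi_pmf UNIV 0 p)" and y: "y \<in> attainable u f i m0"
  shows "EU u i s y \<le> EU u i s (g m0)"
proof (rule ccontr)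
  assume "\<not> ?thesis"
  then have less: "EU u i s (g m0) < EU u i s y" by simp
  let ?P = "Pi_pmf UNIV 0 p"
  obtain B where B: "\<And>y. \<bar>EU u i s y\<bar> \<le> B" by (rule EU_bounded[of u i s]) blast
  then have B0: "0 \<le> B" by (meson abs_ge_zero order_trans)
  \<comment> \<open>A hypothetical outcome function, improved at the single profile
    \<open>m0\<close>.\<close>
  define r where "r = (g(m0 := y))"
  define outbid where "outbid m k \<longleftrightarrow> (\<forall>j. j \<noteq> i \<longrightarrow> snd (from_nat (m j) :: 'th \<times> nat) < k)" for m k
  \<comment> \<open>Loss from claiming \<open>(s, k)\<close> instead of obtaining
    \<open>r m\<close>: small once \<open>k\<close> outbids the others, and otherwise bounded by the
    range of utilities.\<close>
  define e where "e k m = (if outbid m k then (1 + 2 * B) / real (Suc k) else 2 * B)" for k m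
  have r: "r m \<in> attainable u f i m" for m
    using y mechanism_attainable by (simp add: r_def)
  have gain: "EU u i s (r m) - e k m \<le> EU u i s (g (m(i := to_nat (s, k))))" for k m
  proof (cases "outbid m k")
    case True
    then have "g (m(i := to_nat (s, k))) = award u i (attainable u f i m) (s, k)"
      by (intro mechanism_outbid) (auto simp: outbid_def)
    then show ?thesis using award_near_optimal[OF B r] True by (simp add: e_def)
  next
    case False
    then show ?thesis using B[of "r m"] B[of "g (m(i := to_nat (s, k)))"] by (simp add: e_def)
  qed
  have e_bound: "\<bar>e k m\<bar> \<le> 1 + 2 * B" for k m
  proof -
    have "(1 + 2 * B) / real (Suc k) \<le> (1 + 2 * B) / 1"
      using B0 by (intro divide_left_mono) auto
    then show ?thesis using B0 by (auto simp: e_def)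
  qed
  have int_e: "integrable (measure_pmf ?P) (e k)" for k
    using e_bound by (intro measure_pmf.integrable_const_bound[where B = "1 + 2 * B"]) auto
  \<comment> \<open>Finitely many agents: each fixed profile is outbid eventually, though not
    uniformly in \<open>m\<close>. Dominated convergence then handles the expectation.\<close>
  have "(\<lambda>k. e k m) \<longlonglongrightarrow> 0" for m
  proof -
    define K where "K = Suc (Max (range (\<lambda>j. snd (from_nat (m j) :: 'th \<times> nat))))"
    have "outbid m k" if "k \<ge> K" for k
      unfolding outbid_def
    proof (intro allI impI)
      fix j
      have "snd (from_nat (m j) :: 'th \<times> nat) \<le> Max (range (\<lambda>j. snd (from_nat (m j) :: 'th \<times> nat)))"
        by (rule Max_ge) auto
      then show "snd (from_nat (m j) :: 'th \<times> nat) < k" using that unfolding K_def by linarith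
    qed
    then have "eventually (\<lambda>k. e k m = (1 + 2 * B) / real (Suc k)) sequentially"
      unfolding eventually_sequentially e_def by (intro exI[of _ K]) auto
    moreover have "(\<lambda>k. (1 + 2 * B) / real (Suc k)) \<longlonglongrightarrow> 0"
      by (rule LIMSEQ_Suc[OF lim_const_over_n])
    ultimately show ?thesis by (simp add: tendsto_cong)
  qed
  then have "(\<lambda>k. measure_pmf.expectation ?P (e k)) \<longlonglongrightarrow> measure_pmf.expectation ?P (\<lambda>_. 0)"
    using e_bound by (intro integral_dominated_convergence[where w = "\<lambda>_. 1 + 2 * B"]) auto
  then have lim: "(\<lambda>k. measure_pmf.expectation ?P (e k)) \<longlonglongrightarrow> 0" by simp
  have bound: "measure_pmf.expectation ?P (\<lambda>m. EU u i s (r m)) - measure_pmf.expectation ?P (e k)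
      \<le> measure_pmf.expectation ?P (\<lambda>m. EU u i s (g m))" for k
  proof -
    have "measure_pmf.expectation ?P (\<lambda>m. EU u i s (r m)) - measure_pmf.expectation ?P (e k) =
        measure_pmf.expectation ?P (\<lambda>m. EU u i s (r m) - e k m)"
      by (intro Bochner_Integration.integral_diff[symmetric] integrable_EU int_e)
    also have "\<dots> \<le> measure_pmf.expectation ?P (\<lambda>m. EU u i s (g (m(i := to_nat (s, k)))))"
      by (intro integral_mono Bochner_Integration.integrable_diff integrable_EU int_e gain)
    also have "\<dots> = EU u i s (outcome g (p(i := return_pmf (to_nat (s, k)))))"
      by (simp add: outcome_pure_deviation EU_bind)
    also have "\<dots> \<le> EU u i s (outcome g p)" using p by (simp add: MNE_def)
    also have "\<dots> = measure_pmf.expectation ?P (\<lambda>m. EU u i s (g m))"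
      by (simp add: outcome_def EU_bind)
    finally show ?thesis .
  qed
  have "measure_pmf.expectation ?P (\<lambda>m. EU u i s (r m)) - 0
      \<le> measure_pmf.expectation ?P (\<lambda>m. EU u i s (g m))"
    using bound by (intro LIMSEQ_le_const2[OF tendsto_diff[OF tendsto_const lim]]) auto
  \<comment> \<open>\<open>r\<close> is nowhere worse than \<open>g\<close>, so a gain with
    nonpositive mean vanishes at \<open>m0\<close>, which has positive probability.\<close>
  then have "measure_pmf.expectation ?P (\<lambda>m. EU u i s (r m) - EU u i s (g m)) \<le> 0"
    by (subst Bochner_Integration.integral_diff) (auto intro: integrable_EU)
  then have "EU u i s (r m0) - EU u i s (g m0) = 0"
    by (intro expectation_nonpos_imp_zero[OF _ _ _ m0] Bochner_Integration.integrable_diff integrable_EU)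
       (use less in \<open>auto simp: r_def\<close>)
  then show False using less by (simp add: r_def)
qed

lemma equilibrium_outcome:
  assumes p: "p \<in> MNE u (\<lambda>_. UNIV) g s" and m: "m \<in> set_pmf (Pi_pmf UNIV 0 p)"
  shows "g m = return_pmf (f s)"
proof -
  have opt: "EU u i s y \<le> EU u i s (g m)" if "y \<in> attainable u f i m" for i y
    using p m that by (rule equilibrium_optimal)
  show ?thesis
  proof (cases "\<exists>\<theta>::'th. \<forall>i. from_nat (m i) = (\<theta>, 0::nat)")
    case True
    then obtain \<theta> where eq: "\<And>i. from_nat (m i) = (\<theta> :: 'th, 0::nat)" by blast
    then have gm: "g m = return_pmf (f \<theta>)" by (rule mechanism_agree)
    \<comment> \<open>Each agent could attain the whole truncated set at the agreed state, so
      optimality is the premise of monotonicity.\<close>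
    have "LYhat u f i (f \<theta>) \<theta> \<subseteq> LY u i (return_pmf (f \<theta>)) s" for i
      using opt[of _ i] attainable_unanimous[of m i \<theta>] gm eq
      by (auto simp: LY_def unanimous_except_def)
    then have "f \<theta> = f s" by (rule monotoneD)
    then show ?thesis using gm by simp
  next
    case False
    obtain w where w: "leads TYPE('th) m w"
      "g m = award u w (attainable u f w m) (from_nat (m w))"
      using mechanism_leader[OF False] by blast
    define S where "S = attainable u f w m"
    define c where "c = center S"
    define t where "t = 1 / real (Suc (snd (from_nat (m w) :: 'th \<times> nat)))"
    define n where "n = near_optimal u w S (fst (from_nat (m w) :: 'th \<times> nat)) (snd (from_nat (m w) :: 'th \<times> nat))"
    have t: "0 < t" "t \<le> 1" by (simp_all add: t_def)
    have gm: "g m = mix t c n" unfolding w(2) award_def c_def S_def t_def n_def by (rule refl)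
    have n: "n \<in> S" unfolding n_def S_def using attainable_nonempty by (rule near_optimal)
    have central: "central S c" unfolding c_def S_def by (rule central_center)
    \<comment> \<open>The ingredient \<open>n\<close> is no better for \<open>w\<close> than
      \<open>g m\<close>, and \<open>c\<close> has positive weight; so \<open>c\<close> is at least
      as good as \<open>g m\<close> and maximal on \<open>S\<close>. Centrality then flattens
      \<open>u w s\<close> on its support.\<close>
    have "measure_pmf.expectation x (u w s) \<le> measure_pmf.expectation c (u w s)" if "x \<in> S" for x
    proof -
      have "EU u w s (g m) = t * EU u w s c + (1 - t) * EU u w s n"
        unfolding gm using t by (simp add: EU_mix)
      moreover have "(1 - t) * EU u w s n \<le> (1 - t) * EU u w s (g m)"
        using opt n t by (intro mult_left_mono) (auto simp: S_def)
      ultimately have "t * EU u w s (g m) \<le> t * EU u w s c" by (simp add: algebra_simps)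
      then have "EU u w s (g m) \<le> EU u w s c" using t by simp
      then show ?thesis using opt[of x w] that by (simp add: S_def EU_eq_expectation)
    qed
    then have flat: "u w s z = measure_pmf.expectation c (u w s)" if "z \<in> set_pmf c" for z
      using central that unfolding central_def by blast
    have best: "u j s z \<le> EU u j s (g m)" if "j \<noteq> w" for j z
    proof -
      \<comment> \<open>Were the others of \<open>j\<close> unanimous, the leader \<open>w\<close>
        would be a second such agent and all would agree.\<close>
      have "attainable u f j m = UNIV"
      proof (rule attainable_cases[of j m])
        fix \<theta> :: 'th assume una: "unanimous_except m j \<theta>"
        obtain \<theta>' :: 'th where "unanimous_except m w \<theta>'" using leads_unanimous[OF w(1) una] by blast
        then show ?thesis using unanimous_except_two[OF una _ that] False by metis
      qed
      then show ?thesis using opt[of "return_pmf z" j] by simp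
    qed
    have "u j s z = EU u j s (g m)" if "j \<noteq> w" "z \<in> set_pmf c" for j z
      using that best set_pmf_mix[OF t, of c n] by (intro EU_max_imp_support) (auto simp: gm)
    then have "is_max_set_at u w s (set_pmf c)"
      using flat best by (auto simp: is_max_set_at_def set_pmf_not_empty)
    then have max: "is_max_set u w (set_pmf c)" by (auto simp: is_max_set_def)
    show ?thesis
    proof (rule attainable_cases[of w m])
      assume "attainable u f w m = UNIV"
      then have "set_pmf (pmf_of_set (UNIV :: 'z set)) \<subseteq> set_pmf c"
        using central unfolding central_def S_def by blast
      then have "set_pmf c = UNIV" by auto
      then show ?thesis using max not_max_set_UNIV by simp
    next
      fix \<theta> :: 'th assume "unanimous_except m w \<theta>" and S': "attainable u f w m = LYhat u f w (f \<theta>) \<theta>"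
      then have single: "LYhat u f w (f \<theta>) \<theta> = {return_pmf (f \<theta>)}"
        using central max not_max_set_UNIV unfolding S_def
        by (intro central_max_set_imp_singleton) auto
      then have gm': "g m = return_pmf (f \<theta>)" using mechanism_attainable[of m w] S' by simp
      \<comment> \<open>The truncated set of \<open>w\<close> is trivial, and everyone else holds a
        global maximum at \<open>s\<close>.\<close>
      have "LYhat u f j (f \<theta>) \<theta> \<subseteq> LY u j (return_pmf (f \<theta>)) s" for j
      proof (cases "j = w")
        case True
        then show ?thesis using single by (simp add: LY_def)
      next
        case False
        then show ?thesis using best[OF False] gm' by (auto simp: LY_def intro!: EU_le)
      qed
      then have "f \<theta> = f s" by (rule monotoneD)
      then show ?thesis using gm' by simp
    qed
  qed
qed

text \<open>A deviator leaves the others unanimous on the true state, so every resulting lottery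
  lies in its lower contour set there.\<close>

lemma truthful_equilibrium:
  "(\<lambda>_. return_pmf (to_nat (s, 0::nat))) \<in> MNE u (\<lambda>_. UNIV) g s"
    (is "?p \<in> _")
  unfolding MNE_def
proof (intro CollectI conjI allI impI)
  show "is_profile (\<lambda>_. UNIV) ?p" by (simp add: is_profile_def)
  fix i \<mu>
  have "outcome g ?p = return_pmf (f s)"
    unfolding outcome_def using mechanism_agree[of _ s] by (simp add: bind_return_pmf)
  moreover have "EU u i s (outcome g (?p(i := \<mu>))) \<le> u i s (f s)"
  proof -
    have "EU u i s (g m) \<le> u i s (f s)" if "m \<in> set_pmf (Pi_pmf UNIV 0 (?p(i := \<mu>)))" for m
    proof -
      have "unanimous_except m i s"
        unfolding unanimous_except_def
      proof (intro allI impI)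
        fix j assume "j \<noteq> i"
        have "m j \<in> set_pmf ((?p(i := \<mu>)) j)"
          using that by (simp add: set_Pi_pmf PiE_dflt_def)
        then show "from_nat (m j) = (s, 0::nat)" using \<open>j \<noteq> i\<close> by simp
      qed
      then have "g m \<in> LYhat u f i (f s) s"
        using mechanism_attainable[of m i] by (simp add: attainable_unanimous)
      then show ?thesis using LYhat_subset_LY[of u f i "f s" s] by (auto simp: LY_def)
    qed
    then have "measure_pmf.expectation (Pi_pmf UNIV 0 (?p(i := \<mu>))) (\<lambda>m. EU u i s (g m))
        \<le> measure_pmf.expectation (Pi_pmf UNIV 0 (?p(i := \<mu>))) (\<lambda>_. u i s (f s))"
      by (intro integral_mono_AE integrable_EU) (auto simp: AE_measure_pmf_iff)
    then show ?thesis by (simp add: outcome_def EU_bind)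
  qed
  ultimately show "EU u i s (outcome g (?p(i := \<mu>))) \<le> EU u i s (outcome g ?p)" by simp
qed

lemma implementable: "mixed_Nash_implementable u f"
  unfolding mixed_Nash_implementable_def
proof (intro exI allI)
  fix s
  have "set_pmf (outcome g p) = {f s}" if "p \<in> MNE u (\<lambda>_. UNIV) g s" for p
    using equilibrium_outcome[OF that] by (auto simp: outcome_def set_pmf_not_empty)
  then show "(\<Union>p\<in>MNE u (\<lambda>_. UNIV) g s. set_pmf (outcome g p)) = {f s}"
    using truthful_equilibrium by auto
qed

end

theorem theorem1:
  fixes u :: "'i::finite \<Rightarrow> 'th::countable \<Rightarrow> 'z::finite \<Rightarrow> real"
    and f :: "'th \<Rightarrow> 'z"
  assumes "CARD('i) \<ge> 3"
    and "card (range f) \<ge> 2"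
  shows "mixed_Nash_implementable u f \<longleftrightarrow> LYhat_monotone u f"
proof
  assume "LYhat_monotone u f"
  then interpret Nash_setting u f using assms by unfold_locales
  show "mixed_Nash_implementable u f" by (rule implementable)
qed (rule implementable_imp_monotone)

end
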